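(* Let $k\ge 2$. For every input vector $v=(\lambda_F,\lambda_B;\delta_1,\ldots,\delta_k)$ in the standard symplectic cone in $\mathbb R^{2+k}$, the algorithm CremonaReduce terminates after finitely many steps.
   Context: The standard symplectic cone in $\mathbb R^{2+k}$ (for blowups of $S^2$-bundles over a surface of positive genus) is $$\mathcal C_0=\Bigl\{(\lambda_F,\lambda_B;\delta_1,\ldots,\delta_k)\in\mathbb R_{>0}^{2+k}\ \Big|\ \lambda_F-\delta_i>0\ \text{for all } i \text{ and } \lambda_F\lambda_B-\tfrac12\sum_{i=1}^k\delta_i^2>0\Bigr\}.$$ For $v=(\lambda_F,\lambda_B;\delta_1,\ldots,\delta_k)$ define $\mathbf{defect}(v)=\delta_1+\delta_2-\lambda_F$ and $$\mathbf{cremona}(v)=(\lambda_F,\ \lambda_B-\mathbf{defect}(v);\ \lambda_F-\delta_2,\ \lambda_F-\delta_1,\ \delta_3,\ldots,\delta_k).$$ $\mathbf{sort}(v)$ permutes the last $k$ entries of $v$ into non-increasing order. The algorithm CremonaReduce, on input $v\in\mathcal C_0$, first replaces $v$ by $\mathbf{sort}(v)$; then, while $\mathbf{defect}(v)>0$, replaces $v$ by $\mathbf{sort}(\mathbf{cremona}(v))$; when the loop ends it returns $v$. *)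

theory Defs
  imports Complex_Main "HOL-Library.While_Combinator"
begin

text \<open>A vector \<open>(\<lambda>\<^sub>F, \<lambda>\<^sub>B; \<delta>\<^sub>1, \<dots>, \<delta>\<^sub>k)\<close> of \<open>\<real>\<^bsup>2+k\<^esup>\<close> is a triple whose last component is the
  list \<open>[\<delta>\<^sub>1, \<dots>, \<delta>\<^sub>k]\<close>, so that \<open>\<delta>\<^sub>i\<close> is the list entry with index \<open>i - 1\<close>.\<close>

type_synonym cone_vec = "real \<times> real \<times> real list"

definition standard_cone :: "nat \<Rightarrow> cone_vec set" where
  "standard_cone k = {(lF, lB, ds).
     length ds = k \<and> lF > 0 \<and> lB > 0 \<and> (\<forall>i<k. ds ! i > 0) \<and>
     (\<forall>i<k. lF - ds ! i > 0) \<and>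
     lF * lB - 1/2 * (\<Sum>i<k. (ds ! i)\<^sup>2) > 0}"

text \<open>The following two functions are meaningful only for \<open>k \<ge> 2\<close>.\<close>

definition defect :: "cone_vec \<Rightarrow> real" where
  "defect = (\<lambda>(lF, lB, ds). ds ! 0 + ds ! 1 - lF)"

definition cremona :: "cone_vec \<Rightarrow> cone_vec" where
  "cremona = (\<lambda>(lF, lB, ds).
     (lF, lB - defect (lF, lB, ds), [lF - ds ! 1, lF - ds ! 0] @ drop 2 ds))"

definition sort_vec :: "cone_vec \<Rightarrow> cone_vec" where
  "sort_vec = (\<lambda>(lF, lB, ds). (lF, lB, rev (sort ds)))"

text \<open>The result is \<open>Some w\<close> if the loop ends after finitely many iterations with final value \<open>w\<close>,
  and \<open>None\<close> if it runs forever.\<close>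

definition cremona_reduce :: "cone_vec \<Rightarrow> cone_vec option" where
  "cremona_reduce v =
     while_option (\<lambda>v. defect v > 0) (\<lambda>v. sort_vec (cremona v)) (sort_vec v)"

end

theory Submission
  imports Defs "HOL-Library.Multiset"
begin

text \<open>A Cremona move fixes \<open>\<lambda>\<^sub>F\<close> and only replaces entries \<open>\<delta>\<close> by \<open>\<lambda>\<^sub>F - \<delta>\<close>, so all entries ever
  occurring lie in the finite set of the initial entries and their reflections. Hence only finitely
  many lists of entries can occur. A move lowers the sum of the entries by twice the defect, so
  while the loop runs no list of entries occurs twice.\<close>

lemma sum_list_rev_sort: "sum_list (rev (sort xs)) = sum_list (xs :: 'a::{linorder,comm_monoid_add} list)"
  by (metis mset_rev mset_sort sum_mset_sum_list)

lemma sort_cremona_pair: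
  "sort_vec (cremona (lF, lB, a # b # ds)) =
     (lF, lB - (a + b - lF), rev (sort ((lF - b) # (lF - a) # ds)))"
  by (simp add: sort_vec_def cremona_def defect_def)

text \<open>The strict inclusion is witnessed by \<open>y\<close>. This turns a strict decrease of
  real sums within a finite set into a decrease of a natural number.\<close>

lemma card_Collect_less_mono:
  fixes f :: "'a \<Rightarrow> 'b::preorder"
  assumes "finite X" "y \<in> X" "f y < f x"
  shows "card {z \<in> X. f z < f y} < card {z \<in> X. f z < f x}"
  using assms by (intro psubset_card_mono) (auto intro: less_trans)

lemma while_sort_cremona_terminates:
  assumes "length ds \<ge> 2"
  shows "\<exists>w. while_option (\<lambda>v. defect v > 0) (\<lambda>v. sort_vec (cremona v)) (lF, lB, ds) = Some w"
proof -
  define S where "S = set ds \<union> (\<lambda>x. lF - x) ` set ds"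
  define X where "X = {xs. set xs \<subseteq> S \<and> length xs = length ds}"
  \<comment> \<open>\<open>F\<close> is pinned to \<open>lF\<close> because \<open>S\<close> is
    built from that value; \<open>B\<close> stays free since it changes with each move and
    \<open>defect\<close> does not read it.\<close>
  define P :: "cone_vec \<Rightarrow> bool" where "P = (\<lambda>(F, B, xs). F = lF \<and> xs \<in> X)"
  define f :: "cone_vec \<Rightarrow> nat"
    where "f = (\<lambda>(F, B, xs). card {zs \<in> X. sum_list zs < sum_list xs})"
  \<comment> \<open>Reflection is an involution, so one round of reflections already closes
    \<open>S\<close>.\<close>
  have refl: "lF - x \<in> S" if "x \<in> S" for x
    using that by (auto simp: S_def)
  have fin: "finite X"
    unfolding X_def by (intro finite_lists_length_eq) (simp add: S_def)
  show ?thesis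
  proof (rule measure_while_option_Some[where P = P and f = f])
    show "P (lF, lB, ds)"
      by (auto simp: P_def X_def S_def)
  next
    fix v assume "P v" and pos: "defect v > 0"
    then obtain B xs where v: "v = (lF, B, xs)" and xs: "xs \<in> X"
      by (cases v) (auto simp: P_def)
    \<comment> \<open>The successor form lets \<open>Suc_le_length_iff\<close> peel off two
      entries.\<close>
    have "length xs \<ge> Suc (Suc 0)"
      using xs assms by (simp add: X_def)
    then obtain a b ys where ab: "xs = a # b # ys"
      by (auto simp: Suc_le_length_iff)
    define zs where "zs = rev (sort ((lF - b) # (lF - a) # ys))"
    have step: "sort_vec (cremona v) = (lF, B - (a + b - lF), zs)"
      by (simp add: v ab sort_cremona_pair zs_def)
    have zs: "zs \<in> X"
      \<comment> \<open>Keeping \<open>sort\<close> folded lets its set and length be read off the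
        unsorted list.\<close>
      using xs refl by (auto simp: X_def ab zs_def simp del: sort_key_simps)
    have "sum_list zs < sum_list xs"
      using pos unfolding zs_def sum_list_rev_sort by (simp add: ab v defect_def)
    with fin zs have "f (sort_vec (cremona v)) < f v"
      unfolding step by (simp add: v f_def card_Collect_less_mono)
    with zs show "P (sort_vec (cremona v)) \<and> f (sort_vec (cremona v)) < f v"
      by (simp add: step P_def)
  qed
qed

theorem lemma6p6:
  fixes k :: nat and v :: cone_vec
  assumes "k \<ge> 2" and "v \<in> standard_cone k"
  shows "\<exists>w. cremona_reduce v = Some w"
proof -
  obtain lF lB ds where v: "v = (lF, lB, ds)"
    by (cases v)
  have "length ds \<ge> 2"
    using assms by (simp add: v standard_cone_def)
  then show ?thesis
    using while_sort_cremona_terminates[of "rev (sort ds)" lF lB]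
    by (simp add: cremona_reduce_def v sort_vec_def)
qed

end
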